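(* Let $X:U\subset\mathbb{R}^2\to\mathbb{R}^3$ be a cylindrical ruled surface in $\mathbb{R}^3$. If $\widehat X^t(s,u)=L(t)X(s,u)$ is a self-similar solution to the mean curvature flow with initial condition $$X(s,u)=\beta(s)+u\,w(s),$$ where $L(t)$ is a homothetic helicoidal motion, $\beta$ is a plane curve, $w(s)=(x_0,y_0,z_0)$ is constant and $|w|=1$, then $X$ is given by one of the following surfaces: (I) $\beta(s)=(0,h(s),q(s))$, where $$a x_0\langle w,\tau\rangle=0,\qquad 2c x_0\langle\beta,\eta\rangle-2b\langle w,\eta\rangle-2a x_0\langle\beta,\tau\rangle=\frac{x_0|\tau|^3\kappa}{|\tau|^2-\langle w,\tau\rangle^2};$$ (II) $\beta(s)=(h(s),q(s),0)$, where $$a\,[h'-x_0\langle w,\tau\rangle]=0,\qquad 2c z_0\langle\beta,\eta\rangle+2b z_0\langle e_1,\eta\rangle-2a q\langle w,\eta\rangle=\frac{z_0|\tau|^3\kappa}{|\tau|^2-\langle w,\tau\rangle^2}.$$ Here $a$, $b$ and $c$ are constants related to the rotation, translation and dilation of the surface $X$ in Euclidean space, and $\tau$, $\eta$ and $\kappa$ are, respectively, the tangent, the normal and the curvature of $\beta$.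
   Context: Maps are smooth and surfaces are immersions. $e_1=(1,0,0)$. Conventions: $\tau=\beta'$ (not necessarily unit); $\eta=(0,q',-h')$ in case (I) and $\eta=(q',-h',0)$ in case (II); in both cases $\kappa=\dfrac{q'h''-q''h'}{(h'^2+q'^2)^{3/2}}$. The homothetic helicoidal motion is taken in the form $L(t)p=\sigma(t)\Gamma(t)p+\Theta(t)$, $t\in\mathfrak I$ (an interval containing $0$), where $\sigma$ is a differentiable real function with $\sigma(0)=1$ and $$\Gamma(t)=\begin{pmatrix}1&0&0\\0&\cos\xi(t)&-\sin\xi(t)\\0&\sin\xi(t)&\cos\xi(t)\end{pmatrix},\qquad \Theta(t)=(\zeta(t),0,0),$$ with $\xi,\zeta$ differentiable, $\xi(0)=\zeta(0)=0$, and $a=\xi'(0)$, $b=\zeta'(0)$, $c=\sigma'(0)$. The mean curvature is $H=\dfrac{Eg-2fF+Ge}{2(EG-F^2)}$, with $E,F,G$ and $e,f,g$ the coefficients of the first and second fundamental forms. The family $\widehat X^t=L(t)X$ is a self-similar solution to the mean curvature flow if $\langle\partial_t\widehat X^t,N^t\rangle=H^t$ for all $t\in\mathfrak I$ and at all points, where $N^t$ is a unit normal of $\widehat X^t$ and $H^t$ its mean curvature with respect to $N^t$.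
   Formalization: "X is given by (I) or (II)" is meant after sliding β along the rulings (u replaced by u+φ(s)) and, only if w=±e_2, after a rotation about the x-axis; as stated it fails for a grim reaper cylinder with w=e_2. If β itself lies in x=0 or z=0, the equations hold for that β. *)

theory Defs
  imports "HOL-Analysis.Analysis"
begin

definition smooth_on :: "real set \<Rightarrow> (real \<Rightarrow> 'a::real_normed_vector) \<Rightarrow> bool" where
  "smooth_on S f \<longleftrightarrow>
     (\<forall>n. \<forall>s\<in>S. ((\<lambda>g x. vector_derivative g (at x)) ^^ n) f differentiable (at s))"

definition plane_curve_on :: "real set \<Rightarrow> (real \<Rightarrow> real^3) \<Rightarrow> bool" where
  "plane_curve_on S \<beta> \<longleftrightarrow> (\<exists>n d. n \<noteq> 0 \<and> (\<forall>s\<in>S. n \<bullet> \<beta> s = d))"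

definition ruled_surface :: "(real \<Rightarrow> real^3) \<Rightarrow> (real \<Rightarrow> real^3) \<Rightarrow> real \<times> real \<Rightarrow> real^3" where
  "ruled_surface \<beta> w = (\<lambda>(s, u). \<beta> s + u *\<^sub>R w s)"

definition immersion_on :: "(real \<times> real) set \<Rightarrow> (real \<times> real \<Rightarrow> real^3) \<Rightarrow> bool" where
  "immersion_on U X \<longleftrightarrow>
     (\<forall>p\<in>U. X differentiable (at p) \<and> inj (frechet_derivative X (at p)))"

definition partial_s :: "(real \<times> real \<Rightarrow> real^3) \<Rightarrow> real \<times> real \<Rightarrow> real^3" where
  "partial_s X = (\<lambda>(s, u). vector_derivative (\<lambda>r. X (r, u)) (at s))"

definition partial_u :: "(real \<times> real \<Rightarrow> real^3) \<Rightarrow> real \<times> real \<Rightarrow> real^3" where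
  "partial_u X = (\<lambda>(s, u). vector_derivative (\<lambda>r. X (s, r)) (at u))"

definition unit_normal_at :: "(real \<times> real \<Rightarrow> real^3) \<Rightarrow> real \<times> real \<Rightarrow> real^3 \<Rightarrow> bool" where
  "unit_normal_at X p \<nu> \<longleftrightarrow> norm \<nu> = 1 \<and> partial_s X p \<bullet> \<nu> = 0 \<and> partial_u X p \<bullet> \<nu> = 0"

definition mean_curvature :: "(real \<times> real \<Rightarrow> real^3) \<Rightarrow> real^3 \<Rightarrow> real \<times> real \<Rightarrow> real" where
  "mean_curvature X \<nu> p =
     (let E = partial_s X p \<bullet> partial_s X p;
          F = partial_s X p \<bullet> partial_u X p;
          G = partial_u X p \<bullet> partial_u X p;
          e = partial_s (partial_s X) p \<bullet> \<nu>;
          f = partial_u (partial_s X) p \<bullet> \<nu>;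
          g = partial_u (partial_u X) p \<bullet> \<nu>
      in (E * g - 2 * F * f + G * e) / (2 * (E * G - F\<^sup>2)))"

definition rotation_x :: "real \<Rightarrow> real^3^3" where
  "rotation_x \<alpha> = vector [vector [1, 0, 0],
                          vector [0, cos \<alpha>, - sin \<alpha>],
                          vector [0, sin \<alpha>, cos \<alpha>]]"

definition homothetic_helicoidal ::
  "(real \<Rightarrow> real) \<Rightarrow> (real \<Rightarrow> real) \<Rightarrow> (real \<Rightarrow> real) \<Rightarrow> real \<Rightarrow> real^3 \<Rightarrow> real^3" where
  "homothetic_helicoidal \<sigma> \<xi> \<zeta> t p =
     \<sigma> t *\<^sub>R (rotation_x (\<xi> t) *v p) + vector [\<zeta> t, 0, 0]"

(* The equation is invariant under N \<mapsto> -N, so no continuity of the normal field is required.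
   The time derivative is one-sided at an endpoint of T. *)
definition self_similar_mcf ::
  "real set \<Rightarrow> (real \<times> real) set \<Rightarrow> (real \<Rightarrow> real^3 \<Rightarrow> real^3) \<Rightarrow> (real \<times> real \<Rightarrow> real^3) \<Rightarrow> bool" where
  "self_similar_mcf T U L X \<longleftrightarrow>
     (\<exists>N. \<forall>t\<in>T. \<forall>p\<in>U.
        unit_normal_at (L t \<circ> X) p (N t p) \<and>
        vector_derivative (\<lambda>r. L r (X p)) (at t within T) \<bullet> N t p
          = mean_curvature (L t \<circ> X) (N t p) p)"

definition signed_curvature :: "(real \<Rightarrow> real) \<Rightarrow> (real \<Rightarrow> real) \<Rightarrow> real \<Rightarrow> real" where
  "signed_curvature h q s =
     (deriv q s * deriv (deriv h) s - deriv (deriv q) s * deriv h s)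
       / ((deriv h s)\<^sup>2 + (deriv q s)\<^sup>2) powr (3/2)"

definition curve_yz :: "(real \<Rightarrow> real) \<Rightarrow> (real \<Rightarrow> real) \<Rightarrow> real \<Rightarrow> real^3" where
  "curve_yz h q s = vector [0, h s, q s]"

definition curve_xy :: "(real \<Rightarrow> real) \<Rightarrow> (real \<Rightarrow> real) \<Rightarrow> real \<Rightarrow> real^3" where
  "curve_xy h q s = vector [h s, q s, 0]"

definition equations_yz ::
  "real \<Rightarrow> real \<Rightarrow> real \<Rightarrow> real^3 \<Rightarrow> (real \<Rightarrow> real) \<Rightarrow> (real \<Rightarrow> real) \<Rightarrow> real \<Rightarrow> bool" where
  "equations_yz a b c w h q s \<longleftrightarrow>
     (let \<beta> = curve_yz h q s;
          \<tau> = vector_derivative (curve_yz h q) (at s);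
          \<eta> = vector [0, deriv q s, - deriv h s];
          \<kappa> = signed_curvature h q s
      in a * w$1 * (w \<bullet> \<tau>) = 0 \<and>
         2 * c * w$1 * (\<beta> \<bullet> \<eta>) - 2 * b * (w \<bullet> \<eta>) - 2 * a * w$1 * (\<beta> \<bullet> \<tau>)
           = w$1 * norm \<tau> ^ 3 * \<kappa> / ((norm \<tau>)\<^sup>2 - (w \<bullet> \<tau>)\<^sup>2))"

definition equations_xy ::
  "real \<Rightarrow> real \<Rightarrow> real \<Rightarrow> real^3 \<Rightarrow> (real \<Rightarrow> real) \<Rightarrow> (real \<Rightarrow> real) \<Rightarrow> real \<Rightarrow> bool" where
  "equations_xy a b c w h q s \<longleftrightarrow>
     (let \<beta> = curve_xy h q s;
          \<tau> = vector_derivative (curve_xy h q) (at s);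
          \<eta> = vector [deriv q s, - deriv h s, 0];
          \<kappa> = signed_curvature h q s;
          e\<^sub>1 = vector [1, 0, 0]
      in a * (deriv h s - w$1 * (w \<bullet> \<tau>)) = 0 \<and>
         2 * c * w$3 * (\<beta> \<bullet> \<eta>) + 2 * b * w$3 * (e\<^sub>1 \<bullet> \<eta>) - 2 * a * q s * (w \<bullet> \<eta>)
           = w$3 * norm \<tau> ^ 3 * \<kappa> / ((norm \<tau>)\<^sup>2 - (w \<bullet> \<tau>)\<^sup>2))"

(* The surface X is, after sliding the directrix by \<phi> along the rulings (same image,
   u replaced by u + \<phi> s), the cylinder with directrix \<gamma> and direction w. *)
definition cylinder_with_directrix ::
  "(real \<times> real) set \<Rightarrow> (real \<times> real \<Rightarrow> real^3) \<Rightarrow> (real \<Rightarrow> real^3) \<Rightarrow> real^3 \<Rightarrow> bool" where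
  "cylinder_with_directrix U X \<gamma> w \<longleftrightarrow>
     (\<exists>\<phi>. smooth_on (fst ` U) \<phi> \<and>
          (\<forall>(s, u)\<in>U. X (s, u) = ruled_surface \<gamma> (\<lambda>_. w) (s, u + \<phi> s)))"

end

theory Submission
  imports Defs
begin

text \<open>
  At time zero the motion is the identity, and its velocity at a point \<open>p\<close> is
  \<open>c p + a (e1 \<times> p) + b e1\<close>. A cylinder \<open>\<beta>(s) + u w\<close> has, along the whole ruling
  over \<open>s\<close>, the same normal direction \<open>n = \<beta>'(s) \<times> w\<close>, and its mean curvature for the unit normal
  \<open>n / |n|\<close> is \<open>\<beta>''(s) \<bullet> n / (2 |n|^3)\<close>. So the flow equation at time zero says that the
  function \<open>u \<mapsto> (c p + a (e1 \<times> p) + b e1) \<bullet> n\<close> with \<open>p = \<beta>(s) + u w\<close>, which is affine in \<open>u\<close>,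
  equals a number that does not depend on \<open>u\<close>. As the domain is open, at least two values of
  \<open>u\<close> occur over each \<open>s\<close>, so the slope \<open>a (e1 \<times> w) \<bullet> n\<close> vanishes and the constant term
  gives the curvature equation. These two conditions together are \<open>soliton_at\<close>; the lemma
  \<open>self_similar_cylinder_soliton_at\<close> carries this step.

  Written in coordinates, with the directrix in the plane \<open>x = 0\<close> or \<open>z = 0\<close>, the condition
  \<open>soliton_at\<close> becomes exactly \<open>equations_yz\<close> or \<open>equations_xy\<close>.

  The directrix can be brought into one of these planes. The condition \<open>soliton_at\<close> survives
  sliding the directrix along the rulings, because \<open>n\<close> does not change and the slope vanishes. It also
  survives a rotation about the \<open>x\<close>-axis, because such a rotation commutes with the motion.
  If \<open>w\<close> has a nonzero first coordinate, the directrix slides into \<open>x = 0\<close>; if it has a nonzero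
  third coordinate, the directrix slides into \<open>z = 0\<close>. Otherwise \<open>w\<close> is parallel to the
  \<open>y\<close>-axis, and a quarter turn about the \<open>x\<close>-axis makes the third coordinate nonzero.
\<close>

unbundle cross3_syntax

section \<open>Smooth curves\<close>

abbreviation velocity :: "(real \<Rightarrow> 'a::real_normed_vector) \<Rightarrow> real \<Rightarrow> 'a" where
  "velocity \<gamma> \<equiv> \<lambda>s. vector_derivative \<gamma> (at s)"

abbreviation acceleration :: "(real \<Rightarrow> 'a::real_normed_vector) \<Rightarrow> real \<Rightarrow> 'a" where
  "acceleration \<gamma> \<equiv> velocity (velocity \<gamma>)"

lemma smooth_on_velocity_iterate:
  assumes "smooth_on S \<gamma>" "s \<in> S"
  shows "((velocity ^^ n) \<gamma> has_vector_derivative (velocity ^^ Suc n) \<gamma> s) (at s)"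
  using assms by (simp add: smooth_on_def vector_derivative_works)

lemma smooth_on_has_velocity:
  assumes "smooth_on S \<gamma>" "s \<in> S"
  shows "(\<gamma> has_vector_derivative velocity \<gamma> s) (at s)"
    and "(velocity \<gamma> has_vector_derivative acceleration \<gamma> s) (at s)"
  using smooth_on_velocity_iterate[OF assms, of 0] smooth_on_velocity_iterate[OF assms, of 1]
  by simp_all

text \<open>
  The equality of iterated derivatives holds only at points of \<open>S\<close>, where \<open>\<gamma>\<close> is known to be
  smooth. Openness of \<open>S\<close> is what allows the next derivative to be taken of an equality
  valid on \<open>S\<close> alone; in the induction each claim feeds the other.
\<close>

lemma velocity_iterate_bounded_linear:
  assumes "open S" "smooth_on S \<gamma>" "bounded_linear A" "s \<in> S"
  shows "(velocity ^^ n) (\<lambda>r. A (\<gamma> r)) s = A ((velocity ^^ n) \<gamma> s)"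
    and "((velocity ^^ n) (\<lambda>r. A (\<gamma> r)) has_vector_derivative A ((velocity ^^ Suc n) \<gamma> s)) (at s)"
proof -
  have "\<forall>s\<in>S. (velocity ^^ n) (\<lambda>r. A (\<gamma> r)) s = A ((velocity ^^ n) \<gamma> s) \<and>
    ((velocity ^^ n) (\<lambda>r. A (\<gamma> r)) has_vector_derivative A ((velocity ^^ Suc n) \<gamma> s)) (at s)"
  proof (induction n)
    case 0
    show ?case
      using bounded_linear.has_vector_derivative[OF assms(3) smooth_on_has_velocity(1)[OF assms(2)]]
      by simp
  next
    case (Suc n)
    have eq: "(velocity ^^ Suc n) (\<lambda>r. A (\<gamma> r)) r = A ((velocity ^^ Suc n) \<gamma> r)" if "r \<in> S" for r
      using Suc that by (auto simp: vector_derivative_at)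
    show ?case
    proof
      fix s assume "s \<in> S"
      have "((\<lambda>r. A ((velocity ^^ Suc n) \<gamma> r)) has_vector_derivative
              A ((velocity ^^ Suc (Suc n)) \<gamma> s)) (at s)"
        by (rule bounded_linear.has_vector_derivative[OF assms(3)
              smooth_on_velocity_iterate[OF assms(2) \<open>s \<in> S\<close>]])
      from has_vector_derivative_transform_within_open[OF this assms(1) \<open>s \<in> S\<close>] eq
      have "((velocity ^^ Suc n) (\<lambda>r. A (\<gamma> r)) has_vector_derivative
              A ((velocity ^^ Suc (Suc n)) \<gamma> s)) (at s)" by metis
      then show "(velocity ^^ Suc n) (\<lambda>r. A (\<gamma> r)) s = A ((velocity ^^ Suc n) \<gamma> s) \<and>
        ((velocity ^^ Suc n) (\<lambda>r. A (\<gamma> r)) has_vector_derivative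
           A ((velocity ^^ Suc (Suc n)) \<gamma> s)) (at s)"
        using eq[OF \<open>s \<in> S\<close>] by blast
    qed
  qed
  then show "(velocity ^^ n) (\<lambda>r. A (\<gamma> r)) s = A ((velocity ^^ n) \<gamma> s)"
    "((velocity ^^ n) (\<lambda>r. A (\<gamma> r)) has_vector_derivative A ((velocity ^^ Suc n) \<gamma> s)) (at s)"
    using assms(4) by auto
qed

lemma smooth_on_bounded_linear:
  assumes "open S" "smooth_on S \<gamma>" "bounded_linear A"
  shows "smooth_on S (\<lambda>r. A (\<gamma> r))"
  unfolding smooth_on_def
  using velocity_iterate_bounded_linear(2)[OF assms] differentiableI_vector by blast

lemma velocity_bounded_linear:
  assumes "open S" "smooth_on S \<gamma>" "bounded_linear A" "s \<in> S"
  shows "velocity (\<lambda>r. A (\<gamma> r)) s = A (velocity \<gamma> s)"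
    and "acceleration (\<lambda>r. A (\<gamma> r)) s = A (acceleration \<gamma> s)"
  using velocity_iterate_bounded_linear(1)[OF assms, of 1]
    velocity_iterate_bounded_linear(1)[OF assms, of 2]
  by (simp_all add: numeral_2_eq_2)

lemma deriv_component:
  fixes \<gamma> :: "real \<Rightarrow> real^'n"
  assumes "open S" "s \<in> S" "(\<gamma> has_vector_derivative v) (at s)" "\<And>r. r \<in> S \<Longrightarrow> f r = \<gamma> r $ i"
  shows "deriv f s = v $ i"
proof -
  have "((\<lambda>r. \<gamma> r $ i) has_vector_derivative v $ i) (at s)"
    by (rule bounded_linear.has_vector_derivative[OF bounded_linear_vec_nth assms(3)])
  then have "(f has_vector_derivative v $ i) (at s)"
    by (rule has_vector_derivative_transform_within_open[OF _ assms(1,2)]) (simp add: assms(4))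
  then show ?thesis
    by (simp add: DERIV_imp_deriv has_real_derivative_iff_has_vector_derivative)
qed

lemma deriv_component_smooth:
  fixes \<gamma> :: "real \<Rightarrow> real^'n"
  assumes "open S" "smooth_on S \<gamma>" "s \<in> S" "\<And>r. r \<in> S \<Longrightarrow> f r = \<gamma> r $ i"
  shows "deriv f s = velocity \<gamma> s $ i" "deriv (deriv f) s = acceleration \<gamma> s $ i"
proof -
  have *: "deriv f r = velocity \<gamma> r $ i" if "r \<in> S" for r
    by (rule deriv_component[OF assms(1) that smooth_on_has_velocity(1)[OF assms(2) that] assms(4)])
  show "deriv f s = velocity \<gamma> s $ i" using * assms(3) .
  show "deriv (deriv f) s = acceleration \<gamma> s $ i"
    by (rule deriv_component[OF assms(1,3) smooth_on_has_velocity(2)[OF assms(2,3)] *])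
qed

section \<open>The pointwise soliton equation of a cylinder\<close>

abbreviation e1 :: "real^3" where "e1 \<equiv> vector [1, 0, 0]"

definition motion_field :: "real \<Rightarrow> real \<Rightarrow> real \<Rightarrow> real^3 \<Rightarrow> real^3" where
  "motion_field a b c p = c *\<^sub>R p + a *\<^sub>R (e1 \<times> p) + b *\<^sub>R e1"

text \<open>
  The arguments \<open>p\<close>, \<open>v\<close>, \<open>k\<close> stand for position, velocity and acceleration of the directrix.
  The first condition says that the flow equation has no term linear in the ruling parameter, and
  the second is what then remains of the equation. Stating both through the cross product \<open>v \<times> w\<close> makes their
  invariance under slides and rotations visible.
\<close>

definition soliton_at :: "real \<Rightarrow> real \<Rightarrow> real \<Rightarrow> real^3 \<Rightarrow> real^3 \<Rightarrow> real^3 \<Rightarrow> real^3 \<Rightarrow> bool" where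
  "soliton_at a b c w p v k \<longleftrightarrow>
     (let n = v \<times> w in
        a * ((e1 \<times> w) \<bullet> n) = 0 \<and> 2 * (motion_field a b c p \<bullet> n) = (k \<bullet> n) / (n \<bullet> n))"

lemma rotation_x_zero: "rotation_x 0 *v p = p"
  by (simp add: rotation_x_def vec_eq_iff forall_3 matrix_vector_mult_def sum_3)

text \<open>
  The axial part of \<open>p\<close> is fixed and the part orthogonal to the axis turns in its plane. In this
  form \<open>\<alpha>\<close> enters only through scalar coefficients, so the motion can be differentiated by the
  product rule.
\<close>

lemma rotation_x_decompose:
  "rotation_x \<alpha> *v p = p $ 1 *\<^sub>R e1 + (cos \<alpha> *\<^sub>R (p - p $ 1 *\<^sub>R e1) + sin \<alpha> *\<^sub>R (e1 \<times> p))"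
  by (simp add: rotation_x_def vec_eq_iff forall_3 matrix_vector_mult_def sum_3 cross3_def)

lemma homothetic_helicoidal_zero:
  assumes "\<sigma> 0 = 1" "\<xi> 0 = 0" "\<zeta> 0 = 0"
  shows "homothetic_helicoidal \<sigma> \<xi> \<zeta> 0 p = p"
proof -
  have "(vector [0, 0, 0] :: real^3) = 0" by (simp add: vec_eq_iff forall_3)
  then show ?thesis by (simp add: homothetic_helicoidal_def assms rotation_x_zero)
qed

lemma homothetic_helicoidal_has_derivative_zero:
  assumes "\<sigma> 0 = 1" "\<xi> 0 = 0"
    and "(\<xi> has_real_derivative a) (at 0 within T)"
    and "(\<zeta> has_real_derivative b) (at 0 within T)"
    and "(\<sigma> has_real_derivative c) (at 0 within T)"
  shows "((\<lambda>r. homothetic_helicoidal \<sigma> \<xi> \<zeta> r p) has_vector_derivative motion_field a b c p)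
           (at 0 within T)"
proof -
  define u where "u = p - p $ 1 *\<^sub>R e1"
  have eq: "homothetic_helicoidal \<sigma> \<xi> \<zeta> r p =
      \<sigma> r *\<^sub>R (p $ 1 *\<^sub>R e1 + (cos (\<xi> r) *\<^sub>R u + sin (\<xi> r) *\<^sub>R (e1 \<times> p))) + \<zeta> r *\<^sub>R e1" for r
    unfolding homothetic_helicoidal_def rotation_x_decompose u_def
    by (simp add: vec_eq_iff forall_3)
  have co: "((\<lambda>r. cos (\<xi> r)) has_real_derivative 0) (at 0 within T)"
    and si: "((\<lambda>r. sin (\<xi> r)) has_real_derivative a) (at 0 within T)"
    using assms(3) by (auto intro!: derivative_eq_intros simp: assms(2))
  have "((\<lambda>r. \<sigma> r *\<^sub>R (p $ 1 *\<^sub>R e1 + (cos (\<xi> r) *\<^sub>R u + sin (\<xi> r) *\<^sub>R (e1 \<times> p))) + \<zeta> r *\<^sub>R e1)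
     has_vector_derivative
      (\<sigma> 0 *\<^sub>R (0 + ((cos (\<xi> 0) *\<^sub>R 0 + 0 *\<^sub>R u) + (sin (\<xi> 0) *\<^sub>R 0 + a *\<^sub>R (e1 \<times> p)))) +
         c *\<^sub>R (p $ 1 *\<^sub>R e1 + (cos (\<xi> 0) *\<^sub>R u + sin (\<xi> 0) *\<^sub>R (e1 \<times> p))))
      + (\<zeta> 0 *\<^sub>R 0 + b *\<^sub>R e1)) (at 0 within T)"
    by (intro has_vector_derivative_add has_vector_derivative_scaleR has_vector_derivative_const
        co si assms)
  then show ?thesis
    by (simp add: eq assms(1,2) motion_field_def u_def add_ac)
qed

lemma motion_field_along_ruling:
  "motion_field a b c (p + u *\<^sub>R w) = motion_field a b c p + u *\<^sub>R (c *\<^sub>R w + a *\<^sub>R (e1 \<times> w))"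
  by (simp add: motion_field_def cross_add_right cross_mult_right algebra_simps)

section \<open>The flow equation of a cylinder at time zero\<close>

text \<open>
  Adding a constant changes neither the existence nor the value of a derivative, so where
  \<open>\<beta>\<close> is not differentiable both sides are the same default value.
\<close>

lemma partials_cylinder:
  fixes \<beta> :: "real \<Rightarrow> real^3" and w :: "real^3"
  defines "X \<equiv> ruled_surface \<beta> (\<lambda>_. w)"
  shows "partial_s X = (\<lambda>(s, u). velocity \<beta> s)" "partial_u X = (\<lambda>_. w)"
    "partial_s (partial_s X) = (\<lambda>(s, u). acceleration \<beta> s)"
    "partial_u (partial_s X) = (\<lambda>_. 0)" "partial_u (partial_u X) = (\<lambda>_. 0)"
proof -
  show s: "partial_s X = (\<lambda>(s, u). velocity \<beta> s)"
    by (simp add: X_def partial_s_def ruled_surface_def vector_derivative_def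
        has_vector_derivative_add_const)
  have "((\<lambda>r. \<beta> s + r *\<^sub>R w) has_vector_derivative w) (at u)" for s u
    by (auto intro!: derivative_eq_intros)
  then show u: "partial_u X = (\<lambda>_. w)"
    by (auto simp: X_def partial_u_def ruled_surface_def fun_eq_iff intro!: vector_derivative_at)
  show "partial_s (partial_s X) = (\<lambda>(s, u). acceleration \<beta> s)"
    "partial_u (partial_s X) = (\<lambda>_. 0)" "partial_u (partial_u X) = (\<lambda>_. 0)"
    unfolding s u by (simp_all add: partial_s_def partial_u_def fun_eq_iff)
qed

text \<open>
  If \<open>v = k w\<close>, then the differential \<open>(x, y) \<mapsto> x v + y w\<close> of the parametrization kills
  \<open>(1, -k)\<close>, which contradicts injectivity.
\<close>

lemma immersed_cylinder_normal_nonzero: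
  assumes "immersion_on U (ruled_surface \<beta> (\<lambda>_. w))" "(s, u) \<in> U"
    and "(\<beta> has_vector_derivative v) (at s)" and "norm w = 1"
  shows "v \<times> w \<noteq> 0"
proof
  assume "v \<times> w = 0"
  then have "collinear {0, w, v}" by (simp add: cross_eq_0 insert_commute)
  moreover have "w \<noteq> 0" using assms(4) by auto
  ultimately obtain k where k: "v = k *\<^sub>R w" by (auto simp: collinear_lemma)
  let ?X = "ruled_surface \<beta> (\<lambda>_. w)"
  have "(\<beta> has_derivative (\<lambda>x. x *\<^sub>R v)) (at (fst (s, u)))"
    using assms(3) by (simp add: has_vector_derivative_def)
  from has_derivative_compose[OF has_derivative_fst[OF has_derivative_ident] this]
  have "((\<lambda>p. \<beta> (fst p) + snd p *\<^sub>R w) has_derivative (\<lambda>d. fst d *\<^sub>R v + snd d *\<^sub>R w)) (at (s, u))"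
    by (intro has_derivative_add has_derivative_scaleR_left has_derivative_snd has_derivative_ident)
  moreover have "?X = (\<lambda>p. \<beta> (fst p) + snd p *\<^sub>R w)"
    by (auto simp: ruled_surface_def)
  ultimately have "(?X has_derivative (\<lambda>d. fst d *\<^sub>R v + snd d *\<^sub>R w)) (at (s, u))"
    by simp
  note differential = frechet_derivative_at[OF this]
  have "inj (\<lambda>d. fst d *\<^sub>R v + snd d *\<^sub>R w)"
    unfolding differential using assms(1,2) unfolding immersion_on_def by blast
  from injD[OF this, of "(1, - k)" "(0, 0)"] show False by (simp add: k)
qed

lemma orthogonal_to_both_imp_multiple_cross:
  assumes "v \<times> w \<noteq> 0" "v \<bullet> \<nu> = 0" "w \<bullet> \<nu> = 0"
  obtains k where "\<nu> = k *\<^sub>R (v \<times> w)"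
proof -
  have "\<nu> \<bullet> v = 0" "\<nu> \<bullet> w = 0" using assms by (simp_all add: inner_commute)
  then have "\<nu> \<times> (v \<times> w) = 0" by (simp add: Lagrange)
  then have "collinear {0, v \<times> w, \<nu>}" by (simp add: cross_eq_0 insert_commute)
  then show ?thesis using assms(1) that by (auto simp: collinear_lemma)
qed

lemma cross_dot_self_unit:
  assumes "norm w = 1"
  shows "(v \<times> w) \<bullet> (v \<times> w) = (norm v)\<^sup>2 - (w \<bullet> v)\<^sup>2"
  using norm_cross_dot[of v w] assms by (simp add: power2_norm_eq_inner[symmetric] inner_commute)

text \<open>
  The flow equation at time zero. Replacing the given unit normal by a multiple \<open>k n\<close> of
  \<open>n = \<beta>' \<times> w\<close> makes both sides linear in \<open>k\<close>, so neither the sign of the normal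
  nor its normalization remains.
\<close>

lemma self_similar_cylinder_initial_equation:
  assumes "immersion_on U (ruled_surface \<beta> (\<lambda>_. w))"
    and "smooth_on (fst ` U) \<beta>" and "norm w = 1"
    and "is_interval T" "0 \<in> T" "T \<noteq> {0}"
    and "\<sigma> 0 = 1" "\<xi> 0 = 0" "\<zeta> 0 = 0"
    and "(\<xi> has_real_derivative a) (at 0 within T)"
    and "(\<zeta> has_real_derivative b) (at 0 within T)"
    and "(\<sigma> has_real_derivative c) (at 0 within T)"
    and "self_similar_mcf T U (homothetic_helicoidal \<sigma> \<xi> \<zeta>) (ruled_surface \<beta> (\<lambda>_. w))"
    and "(s, u) \<in> U"
  defines "n \<equiv> velocity \<beta> s \<times> w"
  shows "2 * (motion_field a b c (\<beta> s + u *\<^sub>R w) \<bullet> n) = (acceleration \<beta> s \<bullet> n) / (n \<bullet> n)"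
proof -
  let ?X = "ruled_surface \<beta> (\<lambda>_. w)" and ?L = "homothetic_helicoidal \<sigma> \<xi> \<zeta>"
  have L0: "?L 0 \<circ> ?X = ?X"
    by (simp add: fun_eq_iff homothetic_helicoidal_zero assms)
  obtain \<nu> where \<nu>: "unit_normal_at ?X (s, u) \<nu>"
    and eq: "vector_derivative (\<lambda>r. ?L r (?X (s, u))) (at 0 within T) \<bullet> \<nu> = mean_curvature ?X \<nu> (s, u)"
    using assms(13,14,5) L0 unfolding self_similar_mcf_def by metis
  have n0: "n \<noteq> 0"
    unfolding n_def using assms(14)
    by (intro immersed_cylinder_normal_nonzero[OF assms(1,14) smooth_on_has_velocity(1)[OF assms(2)] assms(3)])
       force
  obtain k where k: "\<nu> = k *\<^sub>R n"
    using \<nu> n0 orthogonal_to_both_imp_multiple_cross[of "velocity \<beta> s" w \<nu>]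
    unfolding n_def unit_normal_at_def partials_cylinder by auto
  have "k \<noteq> 0" using \<nu> k by (auto simp: unit_normal_at_def)
  \<comment> \<open>A nondegenerate interval accumulates at each of its points, so that the derivative
    within \<open>T\<close> is unique, even at an endpoint.\<close>
  have "0 islimpt T"
    using assms(4-6) by (intro connected_imp_perfect) (auto simp: is_interval_connected)
  then have "vector_derivative (\<lambda>r. ?L r (?X (s, u))) (at 0 within T) = motion_field a b c (?X (s, u))"
    by (intro vector_derivative_within homothetic_helicoidal_has_derivative_zero assms)
       (simp add: trivial_limit_within)
  moreover have "mean_curvature ?X \<nu> (s, u) = (acceleration \<beta> s \<bullet> \<nu>) / (2 * (n \<bullet> n))"
  proof -
    have ww: "w \<bullet> w = 1" using assms(3) by (simp add: norm_eq_1)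
    have D: "velocity \<beta> s \<bullet> velocity \<beta> s - (velocity \<beta> s \<bullet> w)\<^sup>2 = n \<bullet> n"
      unfolding n_def cross_dot_self_unit[OF assms(3)] power2_norm_eq_inner
      by (simp only: inner_commute)
    show ?thesis
      unfolding mean_curvature_def partials_cylinder(3-5) unfolding partials_cylinder(1,2)
      by (simp only: Let_def prod.case inner_zero_left mult_zero_right ww mult_1 mult_1_right D
          diff_zero add_0)
  qed
  ultimately have "k * (motion_field a b c (\<beta> s + u *\<^sub>R w) \<bullet> n) = k * (acceleration \<beta> s \<bullet> n) / (2 * (n \<bullet> n))"
    using eq k by (simp add: ruled_surface_def)
  then show ?thesis using \<open>k \<noteq> 0\<close> n0 by (simp add: field_simps)
qed

text \<open>
  In the equation at time zero the left-hand side is affine in the ruling parameter and the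
  right-hand side does not contain it. Two points of \<open>U\<close> on the same ruling force the slope to vanish.
\<close>

lemma self_similar_cylinder_soliton_at:
  assumes "open U" and hyps:
    "immersion_on U (ruled_surface \<beta> (\<lambda>_. w))"
    "smooth_on (fst ` U) \<beta>" "norm w = 1"
    "is_interval T" "0 \<in> T" "T \<noteq> {0}"
    "\<sigma> 0 = 1" "\<xi> 0 = 0" "\<zeta> 0 = 0"
    "(\<xi> has_real_derivative a) (at 0 within T)"
    "(\<zeta> has_real_derivative b) (at 0 within T)"
    "(\<sigma> has_real_derivative c) (at 0 within T)"
    "self_similar_mcf T U (homothetic_helicoidal \<sigma> \<xi> \<zeta>) (ruled_surface \<beta> (\<lambda>_. w))"
    and "s \<in> fst ` U"
  shows "soliton_at a b c w (\<beta> s) (velocity \<beta> s) (acceleration \<beta> s)"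
proof -
  define n where "n = velocity \<beta> s \<times> w"
  obtain u where u: "(s, u) \<in> U" using assms(15) by auto
  have "open {u. (s, u) \<in> U}"
    using continuous_open_vimage[OF assms(1), of "\<lambda>u. (s, u)"]
    by (simp add: vimage_def continuous_on_Pair)
  then have "{u. (s, u) \<in> U} \<noteq> {u}" using not_open_singleton[of u] by metis
  then obtain u' where u': "(s, u') \<in> U" "u' \<noteq> u" using u by auto
  \<comment> \<open>Slope and intercept of the left-hand side as a function of the ruling parameter.\<close>
  define x where "x = (c *\<^sub>R w + a *\<^sub>R (e1 \<times> w)) \<bullet> n"
  define y where "y = motion_field a b c (\<beta> s) \<bullet> n"
  have eq: "2 * (y + r * x) = (acceleration \<beta> s \<bullet> n) / (n \<bullet> n)" if "(s, r) \<in> U" for r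
    using self_similar_cylinder_initial_equation[OF hyps that]
    unfolding n_def[symmetric] motion_field_along_ruling x_def y_def
    by (simp only: inner_add_left inner_scaleR_left)
  have "2 * (y + u * x) = 2 * (y + u' * x)" by (simp only: eq[OF u] eq[OF u'(1)])
  then have "x = 0" using u'(2) by simp
  have "a * ((e1 \<times> w) \<bullet> n) = 0"
    using \<open>x = 0\<close>
    unfolding x_def n_def inner_add_left inner_scaleR_left dot_cross_self(2) by simp
  moreover have "2 * y = (acceleration \<beta> s \<bullet> n) / (n \<bullet> n)"
    using eq[OF u] \<open>x = 0\<close> by simp
  ultimately show ?thesis
    unfolding soliton_at_def Let_def n_def[symmetric] y_def[symmetric] by blast
qed

section \<open>Invariance under slides and rotations about the axis\<close>

text \<open>
  The normal \<open>v \<times> w\<close> is unchanged and orthogonal to \<open>w\<close>. The only term that could change is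
  \<open>x a (e1 \<times> w) \<bullet> (v \<times> w)\<close>, and it is zero by the first condition. The numbers \<open>x\<close>, \<open>y\<close>,
  \<open>z\<close> are the sliding function and its first two derivatives at one parameter value.
\<close>

lemma soliton_at_slide:
  assumes "soliton_at a b c w p v k"
  shows "soliton_at a b c w (p - x *\<^sub>R w) (v - y *\<^sub>R w) (k - z *\<^sub>R w)"
proof -
  have "(v - y *\<^sub>R w) \<times> w = v \<times> w"
    by (simp add: Cross3.left_diff_distrib cross_mult_left)
  moreover have "motion_field a b c (p - x *\<^sub>R w) = motion_field a b c p - x *\<^sub>R (c *\<^sub>R w + a *\<^sub>R (e1 \<times> w))"
    using motion_field_along_ruling[of a b c p "- x" w] by simp
  moreover have "w \<bullet> (v \<times> w) = 0" by (simp add: dot_cross_self)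
  ultimately show ?thesis
    using assms by (simp add: soliton_at_def Let_def inner_diff_left inner_add_left)
qed

lemma rotation_matrix_rotation_x: "rotation_matrix (rotation_x \<theta>)"
  using sin_cos_squared_add[of \<theta>]
  by (simp add: rotation_matrix_def orthogonal_matrix rotation_x_def det_3 vec_eq_iff forall_3
      matrix_matrix_mult_def transpose_def mat_def sum_3 power2_eq_square)

lemma rotation_x_dot: "(rotation_x \<theta> *v p) \<bullet> (rotation_x \<theta> *v q) = p \<bullet> q"
proof -
  have "orthogonal_transformation ((*v) (rotation_x \<theta>))"
    using rotation_matrix_rotation_x[of \<theta>]
    by (simp add: rotation_matrix_def orthogonal_transformation_matrix)
  then show ?thesis by (simp add: orthogonal_transformation_def)
qed

lemma rotation_x_cross:
  "(rotation_x \<theta> *v p) \<times> (rotation_x \<theta> *v q) = rotation_x \<theta> *v (p \<times> q)"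
  by (rule cross_rotation_matrix[OF rotation_matrix_rotation_x])

lemma rotation_x_axis: "rotation_x \<theta> *v e1 = e1"
  by (simp add: rotation_x_def vec_eq_iff forall_3 matrix_vector_mult_def sum_3)

text \<open>
  A rotation about the axis of the motion fixes \<open>e1\<close>, hence commutes with \<open>motion_field\<close>, and
  preserves dot and cross products.
\<close>

lemma soliton_at_rotate:
  assumes "soliton_at a b c w p v k"
  shows "soliton_at a b c (rotation_x \<theta> *v w) (rotation_x \<theta> *v p) (rotation_x \<theta> *v v) (rotation_x \<theta> *v k)"
proof -
  let ?R = "\<lambda>p. rotation_x \<theta> *v p"
  have e1: "e1 \<times> ?R p = ?R (e1 \<times> p)" for p
    using rotation_x_cross[of \<theta> e1 p] by (simp add: rotation_x_axis)
  have "motion_field a b c (?R p) = ?R (motion_field a b c p)"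
    by (simp add: motion_field_def e1 matrix_vector_right_distrib matrix_vector_mult_scaleR rotation_x_axis)
  then show ?thesis
    using assms by (simp add: soliton_at_def Let_def e1 rotation_x_cross rotation_x_dot)
qed

section \<open>The equations for a directrix in a coordinate plane\<close>

text \<open>
  Where the curve is not regular, both sides are zero.
\<close>

lemma norm_cubed_signed_curvature:
  "sqrt ((deriv h s)\<^sup>2 + (deriv q s)\<^sup>2) ^ 3 * signed_curvature h q s
     = deriv q s * deriv (deriv h) s - deriv (deriv q) s * deriv h s"
proof (cases "(deriv h s)\<^sup>2 + (deriv q s)\<^sup>2 = 0")
  case True
  then show ?thesis by (simp add: sum_power2_eq_zero_iff)
next
  case False
  define r where "r = (deriv h s)\<^sup>2 + (deriv q s)\<^sup>2"
  have "r > 0" using False by (simp add: r_def less_le)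
  then have "r powr (3/2) = sqrt r ^ 3"
    by (simp add: powr_half_sqrt[symmetric] powr_power)
  then show ?thesis using \<open>r > 0\<close> by (simp add: signed_curvature_def r_def)
qed

text \<open>
  The Binet-Cauchy identity turns the slope in \<open>soliton_at\<close> into the form in which it occurs in
  the equations for coordinate planes; \<open>v $ 1\<close> is zero in the plane \<open>x = 0\<close> and is \<open>h'\<close> in the
  plane \<open>z = 0\<close>.
\<close>

lemma rotation_speed_along_ruling:
  assumes "norm w = 1"
  shows "(e1 \<times> w) \<bullet> (v \<times> w) = v $ 1 - w $ 1 * (w \<bullet> v)"
proof -
  have "(e1 \<times> w) \<bullet> (v \<times> w) = (e1 \<bullet> v) * (w \<bullet> w) - (e1 \<bullet> w) * (w \<bullet> v)"
    by (simp add: dot_cross inner_commute)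
  moreover have "e1 \<bullet> z = z $ 1" for z by (simp add: inner_vec_def sum_3)
  ultimately show ?thesis using assms by (simp add: norm_eq_1)
qed

text \<open>
  For a directrix in the plane \<open>x = 0\<close> the normal is
  \<open>v \<times> w = x0 \<eta> - (w \<bullet> \<eta>) e1\<close>, where \<open>x0\<close> is the first coordinate of \<open>w\<close>; moreover
  \<open>(e1 \<times> \<gamma>) \<bullet> \<eta> = - \<gamma> \<bullet> v\<close>. Where \<open>v \<times> w = 0\<close>, the quotients on both
  sides of the equivalence have denominator zero and so take the value zero.
\<close>

lemma equations_yz_iff_soliton_at:
  assumes "open S" "smooth_on S \<gamma>" "s \<in> S" "norm w = 1" "\<And>r. r \<in> S \<Longrightarrow> \<gamma> r = curve_yz h q r"
  shows "equations_yz a b c w h q s \<longleftrightarrow> soliton_at a b c w (\<gamma> s) (velocity \<gamma> s) (acceleration \<gamma> s)"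
proof -
  note d = deriv_component_smooth[OF assms(1-3)]
  define \<eta> :: "real^3" where "\<eta> = vector [0, deriv q s, - deriv h s]"
  define v where "v = velocity \<gamma> s"
  have v: "v = vector [0, deriv h s, deriv q s]"
    using d(1)[of "\<lambda>_. 0" 1] d(1)[of h 2] d(1)[of q 3]
    by (simp add: assms(5) v_def curve_yz_def vec_eq_iff forall_3)
  have k: "acceleration \<gamma> s = vector [0, deriv (deriv h) s, deriv (deriv q) s]"
    using d(2)[of "\<lambda>_. 0" 1] d(2)[of h 2] d(2)[of q 3]
    by (simp add: assms(5) curve_yz_def vec_eq_iff forall_3)
  have velocity_curve: "velocity (curve_yz h q) s = v"
    using has_vector_derivative_transform_within_open[OF smooth_on_has_velocity(1)[OF assms(2,3)]
        assms(1,3) assms(5)] unfolding v_def by (rule vector_derivative_at)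
  have norm_v: "norm v = sqrt ((deriv h s)\<^sup>2 + (deriv q s)\<^sup>2)"
    by (simp add: v norm_eq_sqrt_inner inner_vec_def sum_3 power2_eq_square)
  have acceleration_normal:
    "acceleration \<gamma> s \<bullet> (v \<times> w) = w $ 1 * norm v ^ 3 * signed_curvature h q s"
    unfolding mult.assoc norm_v norm_cubed_signed_curvature
    by (simp add: v k cross3_def inner_vec_def sum_3 algebra_simps)
  have motion_normal: "2 * (motion_field a b c (\<gamma> s) \<bullet> (v \<times> w)) = 2 * c * w $ 1 * (curve_yz h q s \<bullet> \<eta>)
      - 2 * b * (w \<bullet> \<eta>) - 2 * a * w $ 1 * (curve_yz h q s \<bullet> v)"
    by (simp add: assms(3,5) v \<eta>_def motion_field_def curve_yz_def cross3_def inner_vec_def sum_3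
        algebra_simps)
  have rotation_normal: "a * ((e1 \<times> w) \<bullet> (v \<times> w)) = 0 \<longleftrightarrow> a * w $ 1 * (w \<bullet> v) = 0"
    unfolding rotation_speed_along_ruling[OF assms(4)] by (simp add: v)
  show ?thesis
    unfolding equations_yz_def soliton_at_def Let_def velocity_curve v_def[symmetric] \<eta>_def[symmetric]
      motion_normal acceleration_normal rotation_normal cross_dot_self_unit[OF assms(4)] ..
qed

text \<open>
  For a directrix in the plane \<open>z = 0\<close> the normal is
  \<open>v \<times> w = z0 \<eta> - (w \<bullet> \<eta>) e3\<close>, where \<open>z0\<close> is the third coordinate of \<open>w\<close>, and
  \<open>e1 \<times> \<gamma> = q e3\<close>; this is where the factor \<open>q (w \<bullet> \<eta>)\<close> comes from.
\<close>

lemma equations_xy_iff_soliton_at: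
  assumes "open S" "smooth_on S \<gamma>" "s \<in> S" "norm w = 1" "\<And>r. r \<in> S \<Longrightarrow> \<gamma> r = curve_xy h q r"
  shows "equations_xy a b c w h q s \<longleftrightarrow> soliton_at a b c w (\<gamma> s) (velocity \<gamma> s) (acceleration \<gamma> s)"
proof -
  note d = deriv_component_smooth[OF assms(1-3)]
  define \<eta> :: "real^3" where "\<eta> = vector [deriv q s, - deriv h s, 0]"
  define v where "v = velocity \<gamma> s"
  have v: "v = vector [deriv h s, deriv q s, 0]"
    using d(1)[of h 1] d(1)[of q 2] d(1)[of "\<lambda>_. 0" 3]
    by (simp add: assms(5) v_def curve_xy_def vec_eq_iff forall_3)
  have k: "acceleration \<gamma> s = vector [deriv (deriv h) s, deriv (deriv q) s, 0]"
    using d(2)[of h 1] d(2)[of q 2] d(2)[of "\<lambda>_. 0" 3]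
    by (simp add: assms(5) curve_xy_def vec_eq_iff forall_3)
  have velocity_curve: "velocity (curve_xy h q) s = v"
    using has_vector_derivative_transform_within_open[OF smooth_on_has_velocity(1)[OF assms(2,3)]
        assms(1,3) assms(5)] unfolding v_def by (rule vector_derivative_at)
  have norm_v: "norm v = sqrt ((deriv h s)\<^sup>2 + (deriv q s)\<^sup>2)"
    by (simp add: v norm_eq_sqrt_inner inner_vec_def sum_3 power2_eq_square)
  have acceleration_normal:
    "acceleration \<gamma> s \<bullet> (v \<times> w) = w $ 3 * norm v ^ 3 * signed_curvature h q s"
    unfolding mult.assoc norm_v norm_cubed_signed_curvature
    by (simp add: v k cross3_def inner_vec_def sum_3 algebra_simps)
  have motion_normal: "2 * (motion_field a b c (\<gamma> s) \<bullet> (v \<times> w)) = 2 * c * w $ 3 * (curve_xy h q s \<bullet> \<eta>)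
      + 2 * b * w $ 3 * (e1 \<bullet> \<eta>) - 2 * a * q s * (w \<bullet> \<eta>)"
    by (simp add: assms(3,5) v \<eta>_def motion_field_def curve_xy_def cross3_def inner_vec_def sum_3
        algebra_simps)
  have rotation_normal: "a * ((e1 \<times> w) \<bullet> (v \<times> w)) = 0 \<longleftrightarrow> a * (deriv h s - w $ 1 * (w \<bullet> v)) = 0"
    unfolding rotation_speed_along_ruling[OF assms(4)] by (simp add: v)
  show ?thesis
    unfolding equations_xy_def soliton_at_def Let_def velocity_curve v_def[symmetric] \<eta>_def[symmetric]
      motion_normal acceleration_normal rotation_normal cross_dot_self_unit[OF assms(4)] ..
qed

section \<open>Bringing the directrix into a coordinate plane\<close>

text \<open>
  The slid curve is the image of \<open>\<beta>\<close> under the linear projection along \<open>w\<close> onto the coordinate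
  plane, so its smoothness and derivatives come from those of \<open>\<beta>\<close> without differentiating the
  sliding function.
\<close>

lemma slide_to_coordinate_plane:
  fixes \<beta> :: "real \<Rightarrow> real^3" and w :: "real^3" and i :: 3
  defines "\<phi> \<equiv> \<lambda>r. \<beta> r $ i / w $ i"
  defines "\<gamma> \<equiv> \<lambda>r. \<beta> r - \<phi> r *\<^sub>R w"
  assumes "open S" "smooth_on S \<beta>" "w $ i \<noteq> 0"
  shows "smooth_on S \<phi>" "smooth_on S \<gamma>" "\<gamma> r $ i = 0" "smooth_on S (\<lambda>r. \<gamma> r $ j)"
    and "s \<in> S \<Longrightarrow> soliton_at a b c w (\<beta> s) (velocity \<beta> s) (acceleration \<beta> s) \<Longrightarrow>
           soliton_at a b c w (\<gamma> s) (velocity \<gamma> s) (acceleration \<gamma> s)"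
proof -
  define A where "A p = p - (p $ i / w $ i) *\<^sub>R w" for p :: "real^3"
  have coord: "bounded_linear (\<lambda>p :: real^3. p $ i / w $ i)"
    by (rule bounded_linear_compose[OF bounded_linear_divide bounded_linear_vec_nth])
  then have A: "bounded_linear A"
    unfolding A_def by (intro bounded_linear_sub bounded_linear_ident bounded_linear_scaleR_const)
  have \<gamma>: "\<gamma> = (\<lambda>r. A (\<beta> r))" by (simp add: \<gamma>_def \<phi>_def A_def)
  show "smooth_on S \<phi>" unfolding \<phi>_def
    by (rule smooth_on_bounded_linear[OF assms(3,4) coord])
  show sm: "smooth_on S \<gamma>" unfolding \<gamma> by (rule smooth_on_bounded_linear[OF assms(3,4) A])
  show "smooth_on S (\<lambda>r. \<gamma> r $ j)"
    by (rule smooth_on_bounded_linear[OF assms(3) sm bounded_linear_vec_nth])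
  show "\<gamma> r $ i = 0" using assms(5) by (simp add: \<gamma>_def \<phi>_def)
  show "soliton_at a b c w (\<gamma> s) (velocity \<gamma> s) (acceleration \<gamma> s)"
    if "s \<in> S" "soliton_at a b c w (\<beta> s) (velocity \<beta> s) (acceleration \<beta> s)"
    using soliton_at_slide[OF that(2)] unfolding \<gamma> velocity_bounded_linear[OF assms(3,4) A that(1)]
    by (simp add: A_def)
qed

lemma cylinder_with_directrix_slide:
  assumes "smooth_on (fst ` U) \<phi>" "\<And>r. r \<in> fst ` U \<Longrightarrow> \<gamma> r = \<beta> r - \<phi> r *\<^sub>R w"
  shows "cylinder_with_directrix U (ruled_surface \<beta> (\<lambda>_. w)) \<gamma> w"
  unfolding cylinder_with_directrix_def
proof (intro exI[of _ \<phi>] conjI assms(1) ballI)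
  fix p assume "p \<in> U"
  then show "case p of (s, u) \<Rightarrow> ruled_surface \<beta> (\<lambda>_. w) (s, u) = ruled_surface \<gamma> (\<lambda>_. w) (s, u + \<phi> s)"
    using assms(2)[of "fst p"] by (auto simp: ruled_surface_def scaleR_left_distrib split: prod.splits)
qed

lemma normal_form_yz:
  assumes "open (fst ` U)" "smooth_on (fst ` U) \<beta>" "norm w = 1" "w $ 1 \<noteq> 0"
    and "\<And>s. s \<in> fst ` U \<Longrightarrow> soliton_at a b c w (\<beta> s) (velocity \<beta> s) (acceleration \<beta> s)"
  shows "\<exists>h q. smooth_on (fst ` U) h \<and> smooth_on (fst ` U) q \<and>
           cylinder_with_directrix U (ruled_surface \<beta> (\<lambda>_. w)) (curve_yz h q) w \<and>
           (\<forall>s\<in>fst ` U. equations_yz a b c w h q s)"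
proof -
  define \<phi> where "\<phi> r = \<beta> r $ 1 / w $ 1" for r
  define \<gamma> where "\<gamma> r = \<beta> r - \<phi> r *\<^sub>R w" for r
  note slide = slide_to_coordinate_plane[OF assms(1,2,4), folded \<phi>_def, folded \<gamma>_def]
  have \<gamma>: "\<gamma> r = curve_yz (\<lambda>r. \<gamma> r $ 2) (\<lambda>r. \<gamma> r $ 3) r" for r
    using slide(3)[of r] by (simp add: curve_yz_def vec_eq_iff forall_3)
  have "cylinder_with_directrix U (ruled_surface \<beta> (\<lambda>_. w)) (curve_yz (\<lambda>r. \<gamma> r $ 2) (\<lambda>r. \<gamma> r $ 3)) w"
    by (rule cylinder_with_directrix_slide[OF slide(1) trans[OF \<gamma>[symmetric] \<gamma>_def]])
  moreover have "equations_yz a b c w (\<lambda>r. \<gamma> r $ 2) (\<lambda>r. \<gamma> r $ 3) s" if "s \<in> fst ` U" for s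
    using equations_yz_iff_soliton_at[OF assms(1) slide(2) that assms(3) \<gamma>]
      slide(5)[OF that assms(5)[OF that]] by simp
  ultimately show ?thesis using slide(4) by blast
qed

lemma normal_form_xy:
  assumes "open (fst ` U)" "smooth_on (fst ` U) \<beta>" "norm w = 1" "w $ 3 \<noteq> 0"
    and "\<And>s. s \<in> fst ` U \<Longrightarrow> soliton_at a b c w (\<beta> s) (velocity \<beta> s) (acceleration \<beta> s)"
  shows "\<exists>h q. smooth_on (fst ` U) h \<and> smooth_on (fst ` U) q \<and>
           cylinder_with_directrix U (ruled_surface \<beta> (\<lambda>_. w)) (curve_xy h q) w \<and>
           (\<forall>s\<in>fst ` U. equations_xy a b c w h q s)"
proof -
  define \<phi> where "\<phi> r = \<beta> r $ 3 / w $ 3" for r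
  define \<gamma> where "\<gamma> r = \<beta> r - \<phi> r *\<^sub>R w" for r
  note slide = slide_to_coordinate_plane[OF assms(1,2,4), folded \<phi>_def, folded \<gamma>_def]
  have \<gamma>: "\<gamma> r = curve_xy (\<lambda>r. \<gamma> r $ 1) (\<lambda>r. \<gamma> r $ 2) r" for r
    using slide(3)[of r] by (simp add: curve_xy_def vec_eq_iff forall_3)
  have "cylinder_with_directrix U (ruled_surface \<beta> (\<lambda>_. w)) (curve_xy (\<lambda>r. \<gamma> r $ 1) (\<lambda>r. \<gamma> r $ 2)) w"
    by (rule cylinder_with_directrix_slide[OF slide(1) trans[OF \<gamma>[symmetric] \<gamma>_def]])
  moreover have "equations_xy a b c w (\<lambda>r. \<gamma> r $ 1) (\<lambda>r. \<gamma> r $ 2) s" if "s \<in> fst ` U" for s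
    using equations_xy_iff_soliton_at[OF assms(1) slide(2) that assms(3) \<gamma>]
      slide(5)[OF that assms(5)[OF that]] by simp
  ultimately show ?thesis using slide(4) by blast
qed

lemma rotate_cylinder:
  fixes \<beta> :: "real \<Rightarrow> real^3" and \<theta> :: real
  assumes "open S" "smooth_on S \<beta>"
  defines "\<gamma> \<equiv> \<lambda>s. rotation_x \<theta> *v \<beta> s"
  shows "(\<lambda>p. rotation_x \<theta> *v ruled_surface \<beta> (\<lambda>_. w) p) = ruled_surface \<gamma> (\<lambda>_. rotation_x \<theta> *v w)"
    and "smooth_on S \<gamma>"
    and "s \<in> S \<Longrightarrow> soliton_at a b c w (\<beta> s) (velocity \<beta> s) (acceleration \<beta> s) \<Longrightarrow>
           soliton_at a b c (rotation_x \<theta> *v w) (\<gamma> s) (velocity \<gamma> s) (acceleration \<gamma> s)"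
proof -
  have R: "bounded_linear (\<lambda>p. rotation_x \<theta> *v p)" by (rule matrix_vector_mul_bounded_linear)
  show "(\<lambda>p. rotation_x \<theta> *v ruled_surface \<beta> (\<lambda>_. w) p) = ruled_surface \<gamma> (\<lambda>_. rotation_x \<theta> *v w)"
    by (auto simp: \<gamma>_def ruled_surface_def matrix_vector_right_distrib matrix_vector_mult_scaleR)
  show "smooth_on S \<gamma>" unfolding \<gamma>_def by (rule smooth_on_bounded_linear[OF assms(1,2) R])
  show "soliton_at a b c (rotation_x \<theta> *v w) (\<gamma> s) (velocity \<gamma> s) (acceleration \<gamma> s)"
    if "s \<in> S" "soliton_at a b c w (\<beta> s) (velocity \<beta> s) (acceleration \<beta> s)"
    unfolding \<gamma>_def velocity_bounded_linear[OF assms(1,2) R that(1)] by (rule soliton_at_rotate[OF that(2)])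
qed

section \<open>Cylindrical self-similar solutions\<close>

theorem theorem3:
  fixes U :: "(real \<times> real) set" and T :: "real set"
    and \<beta> :: "real \<Rightarrow> real^3" and w :: "real^3" and X :: "real \<times> real \<Rightarrow> real^3"
    and x\<^sub>0 y\<^sub>0 z\<^sub>0 a b c :: real and \<sigma> \<xi> \<zeta> :: "real \<Rightarrow> real"
  assumes "open U"
    and "smooth_on (fst ` U) \<beta>"
    and "plane_curve_on (fst ` U) \<beta>"
    and w: "w = vector [x\<^sub>0, y\<^sub>0, z\<^sub>0]" and "norm w = 1"
    and X: "X = ruled_surface \<beta> (\<lambda>_. w)"
    and "immersion_on U X"
    and "is_interval T" and "0 \<in> T" and "T \<noteq> {0}"
    and "\<sigma> differentiable_on T" and "\<xi> differentiable_on T" and "\<zeta> differentiable_on T"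
    and "\<sigma> 0 = 1" and "\<xi> 0 = 0" and "\<zeta> 0 = 0"
    and "(\<xi> has_real_derivative a) (at 0 within T)"
    and "(\<zeta> has_real_derivative b) (at 0 within T)"
    and "(\<sigma> has_real_derivative c) (at 0 within T)"
    and "self_similar_mcf T U (homothetic_helicoidal \<sigma> \<xi> \<zeta>) X"
  shows "(\<exists>\<theta> h q.
            (\<theta> \<noteq> 0 \<longrightarrow> x\<^sub>0 = 0 \<and> z\<^sub>0 = 0) \<and>
            smooth_on (fst ` U) h \<and> smooth_on (fst ` U) q \<and>
            (cylinder_with_directrix U (\<lambda>p. rotation_x \<theta> *v X p) (curve_yz h q) (rotation_x \<theta> *v w) \<and>
               (\<forall>s\<in>fst ` U. equations_yz a b c (rotation_x \<theta> *v w) h q s)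
             \<or>
             cylinder_with_directrix U (\<lambda>p. rotation_x \<theta> *v X p) (curve_xy h q) (rotation_x \<theta> *v w) \<and>
               (\<forall>s\<in>fst ` U. equations_xy a b c (rotation_x \<theta> *v w) h q s)))
         \<and> (\<forall>h q. (\<forall>s\<in>fst ` U. \<beta> s = curve_yz h q s) \<longrightarrow>
                  (\<forall>s\<in>fst ` U. equations_yz a b c w h q s))
         \<and> (\<forall>h q. (\<forall>s\<in>fst ` U. \<beta> s = curve_xy h q s) \<longrightarrow>
                  (\<forall>s\<in>fst ` U. equations_xy a b c w h q s))"
proof -
  have S: "open (fst ` U)" using assms(1) by (rule open_image_fst)
  have sol: "soliton_at a b c w (\<beta> s) (velocity \<beta> s) (acceleration \<beta> s)" if "s \<in> fst ` U" for s
    using assms(1,2,5,7-20) that unfolding X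
    by (intro self_similar_cylinder_soliton_at[of U \<beta> w T \<sigma> \<xi> \<zeta>])
  have comp: "w $ 1 = x\<^sub>0" "w $ 2 = y\<^sub>0" "w $ 3 = z\<^sub>0" by (simp_all add: w)
  have normal_form: "\<exists>\<theta> h q.
            (\<theta> \<noteq> 0 \<longrightarrow> x\<^sub>0 = 0 \<and> z\<^sub>0 = 0) \<and>
            smooth_on (fst ` U) h \<and> smooth_on (fst ` U) q \<and>
            (cylinder_with_directrix U (\<lambda>p. rotation_x \<theta> *v X p) (curve_yz h q) (rotation_x \<theta> *v w) \<and>
               (\<forall>s\<in>fst ` U. equations_yz a b c (rotation_x \<theta> *v w) h q s)
             \<or>
             cylinder_with_directrix U (\<lambda>p. rotation_x \<theta> *v X p) (curve_xy h q) (rotation_x \<theta> *v w) \<and>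
               (\<forall>s\<in>fst ` U. equations_xy a b c (rotation_x \<theta> *v w) h q s))"
  proof (cases "x\<^sub>0 = 0")
    case False
    then have "w $ 1 \<noteq> 0" by (simp add: comp)
    from normal_form_yz[OF S assms(2,5) this sol] show ?thesis
      unfolding X[symmetric] by (intro exI[of _ 0]) (simp add: rotation_x_zero, blast)
  next
    case True
    \<comment> \<open>For \<open>w\<close> parallel to the \<open>y\<close>-axis, a quarter turn takes its second coordinate to the third.\<close>
    define \<theta> :: real where "\<theta> = (if z\<^sub>0 = 0 then pi / 2 else 0)"
    define R where "R p = rotation_x \<theta> *v p" for p
    have "norm (R w) = 1"
      using assms(5) rotation_x_dot[of \<theta> w w] by (simp add: R_def norm_eq_1)
    moreover have "R w $ 3 \<noteq> 0"
    proof (cases "z\<^sub>0 = 0")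
      case z: True
      then have "R w $ 3 = y\<^sub>0"
        by (simp add: R_def \<theta>_def rotation_x_def matrix_vector_mult_def sum_3 comp)
      moreover have "y\<^sub>0 \<noteq> 0"
        using assms(5) True z by (auto simp: norm_eq_1 inner_vec_def sum_3 comp)
      ultimately show ?thesis by simp
    qed (simp add: R_def \<theta>_def rotation_x_zero comp)
    ultimately obtain h q where "smooth_on (fst ` U) h" "smooth_on (fst ` U) q"
      "cylinder_with_directrix U (\<lambda>p. R (X p)) (curve_xy h q) (R w)"
      "\<forall>s\<in>fst ` U. equations_xy a b c (R w) h q s"
      using normal_form_xy[OF S rotate_cylinder(2)[OF S assms(2), of \<theta>] _ _
          rotate_cylinder(3)[OF S assms(2) _ sol, of _ \<theta>]]
      unfolding R_def X rotate_cylinder(1)[OF S assms(2)] by blast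
    moreover have "\<theta> \<noteq> 0 \<longrightarrow> x\<^sub>0 = 0 \<and> z\<^sub>0 = 0"
      using True by (simp add: \<theta>_def)
    ultimately show ?thesis unfolding R_def by blast
  qed
  show ?thesis
  proof (intro conjI allI impI ballI)
    show "equations_yz a b c w h q s"
      if "\<forall>s\<in>fst ` U. \<beta> s = curve_yz h q s" "s \<in> fst ` U" for h q s
      using equations_yz_iff_soliton_at[OF S assms(2) that(2) assms(5)] that sol by blast
    show "equations_xy a b c w h q s"
      if "\<forall>s\<in>fst ` U. \<beta> s = curve_xy h q s" "s \<in> fst ` U" for h q s
      using equations_xy_iff_soliton_at[OF S assms(2) that(2) assms(5)] that sol by blast
  qed (rule normal_form)
qed

end
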